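(* Let $n\ge 1$ and let $(W,S)$ be a Coxeter system with $|W|<\infty$ and $|S|=n$. Then $\mathrm{Cubes}_n(W,S)\geq 1$, i.e. there exists at least one Coxeter $n$-cube in $(W,S)$.
   Context: Let $(W,S)$ be a Coxeter system with Coxeter matrix $m$. Let $V$ be the real vector space with basis $\Pi=\{\alpha_s \mid s\in S\}$ (the simple roots), with symmetric bilinear form $B(\alpha_s,\alpha_{s'})=-\cos(\pi/m(s,s'))$ (equal to $-1$ if $m(s,s')=\infty$). $W$ acts on $V$ by $s(v)=v-2B(v,\alpha_s)\alpha_s$ for $s\in S$. Put $\Phi=\{w(\alpha_s)\mid w\in W, s\in S\}$, let $\Phi^+$ be the set of elements of $\Phi$ that are nonnegative linear combinations of $\Pi$, and $\Phi^-=-\Phi^+$. The left inversion set of $w\in W$ is $\Phi_w=\{\beta\in\Phi^+ \mid w^{-1}(\beta)\in\Phi^-\}$. Coxeter cubes. A Coxeter square is a quadruple $(w,x,y,z)\in (W\setminus\{1\})^4$ with $wx=yz$ and $w(\Phi_x)=\Phi_y$. It is pictured as a commutative square in which $x$ and $z$ label the two edges leaving the initial vertex, $w$ labels the edge following $x$, and $y$ labels the edge following $z$. For $n\ge1$, consider the oriented cube with vertex set $\{0,1\}^n$ and a directed edge $(v,i)$ from $v$ to $v+e_i$ whenever $v_i=0$ ($e_i$ the $i$-th unit vector). A Coxeter $n$-cube in $(W,S)$ is a labelling $\lambda$ of these edges by elements of $W\setminus\{1\}$ such that for all $i\ne j$ and all $v$ with $v_i=v_j=0$, the quadruple $(\lambda(v+e_i,j),\lambda(v,i),\lambda(v+e_j,i),\lambda(v,j))$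 is a Coxeter square (for $n=1$ it is just one labelled edge). Reorientation. The flip in direction $i$ reverses all edges parallel to direction $i$ and inverts their labels: it replaces $\lambda$ by $\lambda'$ with $\lambda'(v,i)=\lambda(v,i)^{-1}$, and for $j\neq i$, $\lambda'(v,j)=\lambda(v^{(i)},j)$ where $v^{(i)}$ is $v$ with its $i$-th coordinate switched. A reorientation of a Coxeter $n$-cube is any labelling obtained by a sequence of such flips and permutations of the $n$ coordinates (reorientations of Coxeter $n$-cubes are again Coxeter $n$-cubes). $\mathrm{Cubes}_n(W,S)$ is the number of Coxeter $n$-cubes in $(W,S)$ modulo reorientation. *)

theory Defs
  imports Complex_Main "HOL-Algebra.Generated_Groups" "HOL-Algebra.Group_Action"
    "HOL-Library.FuncSet"
    "HOL-Library.Extended_Nat" "HOL-Combinatorics.Permutations"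
begin

section \<open>Coxeter systems\<close>

text \<open>Coxeter matrices take values in the natural numbers; the value 0 encodes infinity.\<close>

definition coxeter_matrix :: "'w set \<Rightarrow> ('w \<Rightarrow> 'w \<Rightarrow> nat) \<Rightarrow> bool" where
  "coxeter_matrix S m \<longleftrightarrow>
     (\<forall>s\<in>S. m s s = 1) \<and>
     (\<forall>s\<in>S. \<forall>t\<in>S. m s t = m t s) \<and>
     (\<forall>s\<in>S. \<forall>t\<in>S. s \<noteq> t \<longrightarrow> m s t = 0 \<or> m s t \<ge> 2)"

text \<open>
  Equality of words in the group presented by the generators \<open>S\<close> and the relators
  \<open>(s t)^m(s,t)\<close>. Words are lists over \<open>S\<close> without formal inverses, because \<open>s s\<close> is itself a
  relator, so each generator is its own inverse. For \<open>m s t = 0\<close> (infinity) the relator is the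
  empty word, so no relation is imposed.
\<close>

inductive word_equiv :: "'w set \<Rightarrow> ('w \<Rightarrow> 'w \<Rightarrow> nat) \<Rightarrow> 'w list \<Rightarrow> 'w list \<Rightarrow> bool"
  for S m where
  relator: "\<lbrakk>us \<in> lists S; vs \<in> lists S; s \<in> S; t \<in> S\<rbrakk>
     \<Longrightarrow> word_equiv S m (us @ concat (replicate (m s t) [s, t]) @ vs) (us @ vs)"
| refl: "us \<in> lists S \<Longrightarrow> word_equiv S m us us"
| sym: "word_equiv S m us vs \<Longrightarrow> word_equiv S m vs us"
| trans: "\<lbrakk>word_equiv S m us vs; word_equiv S m vs ws\<rbrakk> \<Longrightarrow> word_equiv S m us ws"

definition word_prod :: "('w, 'b) monoid_scheme \<Rightarrow> 'w list \<Rightarrow> 'w" where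
  "word_prod G xs = foldr (\<lambda>x y. x \<otimes>\<^bsub>G\<^esub> y) xs \<one>\<^bsub>G\<^esub>"

locale coxeter_system = group W for W (structure) +
  fixes S :: "'a set" and m :: "'a \<Rightarrow> 'a \<Rightarrow> nat"
  assumes S_subset: "S \<subseteq> carrier W"
    and matrix: "coxeter_matrix S m"
    and generates: "generate W S = carrier W"
    and presentation: "\<And>xs ys. \<lbrakk>xs \<in> lists S; ys \<in> lists S\<rbrakk>
          \<Longrightarrow> word_prod W xs = word_prod W ys \<longleftrightarrow> word_equiv S m xs ys"
begin

section \<open>The geometric representation and roots\<close>

text \<open>
  A vector is represented by its coordinates with respect to the basis of simple roots, that is,
  by a finitely supported real function on \<open>S\<close>, extended by 0.
\<close>

definition V :: "('a \<Rightarrow> real) set" where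
  "V = {v. finite {s. v s \<noteq> 0} \<and> {s. v s \<noteq> 0} \<subseteq> S}"

definition simple_root :: "'a \<Rightarrow> 'a \<Rightarrow> real" where
  "simple_root s = (\<lambda>t. if t = s then 1 else 0)"

definition B :: "('a \<Rightarrow> real) \<Rightarrow> ('a \<Rightarrow> real) \<Rightarrow> real" where
  "B u v = (\<Sum>s | u s \<noteq> 0. \<Sum>t | v t \<noteq> 0.
     u s * v t * (if m s t = 0 then - 1 else - cos (pi / real (m s t))))"

definition reflection :: "'a \<Rightarrow> ('a \<Rightarrow> real) \<Rightarrow> 'a \<Rightarrow> real" where
  "reflection s v = (\<lambda>t. v t - 2 * B v (simple_root s) * simple_root s t)"

text \<open>
  The action of \<open>W\<close> on \<open>V\<close> in which each generator acts by its reflection. Such an action exists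
  because the reflections satisfy the defining relations, and it is unique on \<open>carrier W\<close>
  because \<open>S\<close> generates \<open>W\<close>.
\<close>

definition act :: "'a \<Rightarrow> ('a \<Rightarrow> real) \<Rightarrow> 'a \<Rightarrow> real" where
  "act = (SOME \<phi>. group_action W V \<phi> \<and> (\<forall>s\<in>S. \<forall>v\<in>V. \<phi> s v = reflection s v))"

definition roots :: "('a \<Rightarrow> real) set" where
  "roots = {act w (simple_root s) | w s. w \<in> carrier W \<and> s \<in> S}"

definition pos_roots :: "('a \<Rightarrow> real) set" where
  "pos_roots = {\<beta> \<in> roots. \<forall>s\<in>S. \<beta> s \<ge> 0}"

definition neg_roots :: "('a \<Rightarrow> real) set" where
  "neg_roots = (\<lambda>\<beta> s. - \<beta> s) ` pos_roots"

definition inversions :: "'a \<Rightarrow> ('a \<Rightarrow> real) set" where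
  "inversions w = {\<beta> \<in> pos_roots. act (inv w) \<beta> \<in> neg_roots}"

section \<open>Coxeter cubes\<close>

definition coxeter_square :: "'a \<Rightarrow> 'a \<Rightarrow> 'a \<Rightarrow> 'a \<Rightarrow> bool" where
  "coxeter_square w x y z \<longleftrightarrow>
     {w, x, y, z} \<subseteq> carrier W - {\<one>} \<and>
     w \<otimes> x = y \<otimes> z \<and>
     act w ` inversions x = inversions y"

end

definition cube_vertices :: "nat \<Rightarrow> (nat \<Rightarrow> nat) set" where
  "cube_vertices n = {..<n} \<rightarrow>\<^sub>E {0, 1}"

text \<open>The pair \<open>(v, i)\<close> is the edge from \<open>v\<close> to \<open>v(i := 1)\<close>; coordinates are indexed from 0.\<close>

definition cube_edges :: "nat \<Rightarrow> ((nat \<Rightarrow> nat) \<times> nat) set" where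
  "cube_edges n = {(v, i). v \<in> cube_vertices n \<and> i < n \<and> v i = 0}"

context coxeter_system
begin

text \<open>Labellings are extensional functions, so that distinct functions are distinct labellings.\<close>

definition coxeter_cubes :: "nat \<Rightarrow> ((nat \<Rightarrow> nat) \<times> nat \<Rightarrow> 'a) set" where
  "coxeter_cubes n = {l \<in> cube_edges n \<rightarrow>\<^sub>E (carrier W - {\<one>}).
     \<forall>v \<in> cube_vertices n. \<forall>i<n. \<forall>j<n. i \<noteq> j \<and> v i = 0 \<and> v j = 0 \<longrightarrow>
       coxeter_square (l (v(i := 1), j)) (l (v, i)) (l (v(j := 1), i)) (l (v, j))}"

definition flip :: "nat \<Rightarrow> nat \<Rightarrow> ((nat \<Rightarrow> nat) \<times> nat \<Rightarrow> 'a) \<Rightarrow> (nat \<Rightarrow> nat) \<times> nat \<Rightarrow> 'a" where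
  "flip n i l = (\<lambda>(v, j) \<in> cube_edges n.
     if j = i then inv (l (v, i)) else l (v(i := 1 - v i), j))"

text \<open>
  The coordinate permutation \<open>\<sigma>\<close> moves coordinate \<open>i\<close> to coordinate \<open>\<sigma> i\<close>; \<open>permute\<close> pulls a
  labelling back along the induced automorphism of the cube.
\<close>

definition permute :: "nat \<Rightarrow> (nat \<Rightarrow> nat) \<Rightarrow> ((nat \<Rightarrow> nat) \<times> nat \<Rightarrow> 'a) \<Rightarrow> (nat \<Rightarrow> nat) \<times> nat \<Rightarrow> 'a" where
  "permute n \<sigma> l = (\<lambda>(v, i) \<in> cube_edges n. l (v \<circ> inv_into UNIV \<sigma>, \<sigma> i))"

definition reorient_step :: "nat \<Rightarrow> ((nat \<Rightarrow> nat) \<times> nat \<Rightarrow> 'a) rel" where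
  "reorient_step n = {(l, flip n i l) | l i. i < n} \<union>
     {(l, permute n \<sigma> l) | l \<sigma>. \<sigma> permutes {..<n}}"

definition reorientation :: "nat \<Rightarrow> ((nat \<Rightarrow> nat) \<times> nat \<Rightarrow> 'a) rel" where
  "reorientation n = (reorient_step n)\<^sup>* \<inter> coxeter_cubes n \<times> coxeter_cubes n"

definition Cubes :: "nat \<Rightarrow> enat" where
  "Cubes n = (let Q = coxeter_cubes n // reorientation n
              in if finite Q then enat (card Q) else \<infinity>)"

end

end

theory Submission
  imports Defs
begin

text \<open>
  For a finite Coxeter group a cube is built one direction at a time along a chain of standard
  parabolic subgroups. Suppose that there is a cube of dimension \<open>|J|\<close> with labels in the parabolic
  subgroup \<open>W_J\<close>, and let \<open>K = J \<union> {s}\<close> with \<open>s \<notin> J\<close>. Write \<open>w_J\<close> for the longest element of \<open>W_J\<close> and put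
  \<open>d = w_K w_J\<close>. In a new direction, all edges get the label \<open>d\<close>; the opposite face carries the
  labels of the old cube conjugated by \<open>d\<close>. So the new squares are of two kinds: a side square
  says \<open>d x = (d x d\<^sup>-\<^sup>1) d\<close> with \<open>x \<in> W_J\<close>, and a square of the opposite face is the conjugate of
  an old one. After \<open>|S|\<close> steps the result has dimension \<open>|S|\<close>.

  The root condition holds because of what \<open>d\<close> does to signs: it reverses the sign of a root
  exactly when the root is supported in \<open>K\<close> and involves \<open>s\<close>. Elements of \<open>W_J\<close> do not change any
  coordinate outside \<open>J\<close>, so they respect this set of roots, and they keep the sign of each root not
  supported in \<open>J\<close>. Comparing signs gives both
  \<open>d (\<Phi>_x) = \<Phi>_(d x d\<^sup>-\<^sup>1)\<close> and \<open>(d x d\<^sup>-\<^sup>1) (\<Phi>_d) = \<Phi>_d\<close> (lemma \<open>relative_longest_square\<close>).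

  Two classical facts about Coxeter systems carry this argument. One is that the geometric
  representation exists (\<open>geometric_action_exists\<close>). The other is that every root is positive or
  negative; it follows from \<open>act_simple_root_nonneg\<close>, by which \<open>w (\<alpha>_s)\<close> is nonnegative as soon as
  multiplying \<open>w\<close> by \<open>s\<close> on the right does not make it shorter. The same lemma shows that an element
  of maximal length in \<open>W_J\<close> makes all simple roots of \<open>J\<close> negative, so that \<open>w_J\<close> exists
  (\<open>longest_element_exists\<close>). Both facts rest on one rank-two computation, the orbit of a simple root
  under alternating products of two reflections (\<open>word_reflection_alternating\<close>).
\<close>

section \<open>Alternating words and dihedral coefficients\<close>

text \<open>
  The value of the \<open>(k - 1)\<close>-st Chebyshev polynomial of the second kind at \<open>q\<close>, that is,
  \<open>sin (k \<theta>) / sin \<theta>\<close> for \<open>q = cos \<theta>\<close>. These numbers are the coordinates of the roots of a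
  dihedral group; the polynomial form also covers \<open>q = 1\<close>, which belongs to the infinite one.
\<close>

fun dihedral_coeff :: "real \<Rightarrow> nat \<Rightarrow> real" where
  "dihedral_coeff q 0 = 0"
| "dihedral_coeff q (Suc 0) = 1"
| "dihedral_coeff q (Suc (Suc k)) = 2 * q * dihedral_coeff q (Suc k) - dihedral_coeff q k"

lemma dihedral_coeff_cos: "dihedral_coeff (cos \<theta>) k * sin \<theta> = sin (real k * \<theta>)"
proof (induction "cos \<theta>" k rule: dihedral_coeff.induct)
  case (3 k)
  have "sin (real (Suc (Suc k)) * \<theta>) + sin (real k * \<theta>) = 2 * sin (real (Suc k) * \<theta>) * cos \<theta>"
    using sin_add[of "real (Suc k) * \<theta>" \<theta>] sin_diff[of "real (Suc k) * \<theta>" \<theta>]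
    by (simp add: algebra_simps)
  then show ?case using 3 by (simp add: algebra_simps)
qed auto

lemma dihedral_coeff_one: "dihedral_coeff 1 k = real k"
  by (induction "1::real" k rule: dihedral_coeff.induct) auto

text \<open>
  Every word that is not empty ends in the second letter \<open>t\<close>, and letters are added in front. So the
  action on a vector applies \<open>t\<close> first, whatever the length of the word is.
\<close>

fun alternating_word :: "nat \<Rightarrow> 'b \<Rightarrow> 'b \<Rightarrow> 'b list" where
  "alternating_word 0 s t = []"
| "alternating_word (Suc k) s t = (if even k then t else s) # alternating_word k s t"

lemma length_alternating_word [simp]: "length (alternating_word k s t) = k"
  by (induction k) auto

lemma set_alternating_word: "set (alternating_word k s t) \<subseteq> {s, t}"
  by (induction k) auto

lemma alternating_word_snoc: "alternating_word (Suc k) s t = alternating_word k t s @ [t]"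
  by (induction k) auto

lemma alternating_word_even: "alternating_word (2 * k) s t = concat (replicate k [s, t])"
  by (induction k) auto

lemma alternating_word_split:
  "alternating_word (j + k) s t = take j (alternating_word (j + k) s t) @ alternating_word k s t"
  by (induction j) auto

context coxeter_system
begin

section \<open>The geometric representation\<close>

definition form_coeff :: "'a \<Rightarrow> 'a \<Rightarrow> real" where
  "form_coeff s t = (if m s t = 0 then - 1 else - cos (pi / real (m s t)))"

lemma m_refl: "s \<in> S \<Longrightarrow> m s s = 1"
  and m_sym: "s \<in> S \<Longrightarrow> t \<in> S \<Longrightarrow> m s t = m t s"
  and m_ge: "s \<in> S \<Longrightarrow> t \<in> S \<Longrightarrow> s \<noteq> t \<Longrightarrow> m s t \<noteq> 0 \<Longrightarrow> m s t \<ge> 2"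
  using matrix by (force simp: coxeter_matrix_def)+

lemma replicate_pair_lists: "s \<in> S \<Longrightarrow> t \<in> S \<Longrightarrow> concat (replicate k [s, t]) \<in> lists S"
  by (induction k) auto

lemma form_coeff_refl: "s \<in> S \<Longrightarrow> form_coeff s s = 1"
  by (simp add: form_coeff_def m_refl)

lemma form_coeff_sym: "s \<in> S \<Longrightarrow> t \<in> S \<Longrightarrow> form_coeff s t = form_coeff t s"
  by (simp add: form_coeff_def m_sym)

lemma simple_root_V: "s \<in> S \<Longrightarrow> simple_root s \<in> V"
  by (auto simp: V_def simple_root_def)

lemma V_outside: "v \<in> V \<Longrightarrow> t \<notin> S \<Longrightarrow> v t = 0"
  by (auto simp: V_def)

lemma V_lincomb:
  assumes "u \<in> V" "v \<in> V"
  shows "(\<lambda>t. a * u t + b * v t) \<in> V"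
proof -
  have "{t. a * u t + b * v t \<noteq> 0} \<subseteq> {t. u t \<noteq> 0} \<union> {t. v t \<noteq> 0}" by auto
  with assms show ?thesis unfolding V_def by (auto intro: finite_subset)
qed

lemma B_simple_root:
  assumes "finite F" "{t. u t \<noteq> 0} \<subseteq> F"
  shows "B u (simple_root s) = (\<Sum>t\<in>F. u t * form_coeff t s)"
proof -
  have s: "{t. simple_root s t \<noteq> 0} = {s}" by (auto simp: simple_root_def)
  have "B u (simple_root s) = (\<Sum>t | u t \<noteq> 0. u t * form_coeff t s)"
    unfolding B_def s by (simp add: form_coeff_def simple_root_def)
  also have "\<dots> = (\<Sum>t\<in>F. u t * form_coeff t s)"
    using assms by (intro sum.mono_neutral_left) auto
  finally show ?thesis .
qed

lemma B_lincomb: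
  assumes "u \<in> V" "v \<in> V"
  shows "B (\<lambda>t. a * u t + b * v t) (simple_root s)
    = a * B u (simple_root s) + b * B v (simple_root s)"
proof -
  let ?F = "{t. u t \<noteq> 0} \<union> {t. v t \<noteq> 0}"
  have F: "finite ?F" using assms by (auto simp: V_def)
  have sub: "{t. a * u t + b * v t \<noteq> 0} \<subseteq> ?F" "{t. u t \<noteq> 0} \<subseteq> ?F" "{t. v t \<noteq> 0} \<subseteq> ?F"
    by auto
  show ?thesis
    unfolding sub[THEN B_simple_root[OF F]]
    by (simp add: sum.distrib sum_distrib_left algebra_simps)
qed

lemma B_simple_simple: "B (simple_root t) (simple_root s) = form_coeff t s"
  by (subst B_simple_root[of "{t}"]) (auto simp: simple_root_def)

lemma reflection_V:
  assumes "s \<in> S" "v \<in> V"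
  shows "reflection s v \<in> V"
  using V_lincomb[OF assms(2) simple_root_V[OF assms(1)], of 1 "- 2 * B v (simple_root s)"]
  by (simp add: reflection_def)

lemma reflection_lincomb:
  assumes "u \<in> V" "v \<in> V"
  shows "reflection s (\<lambda>t. a * u t + b * v t) = (\<lambda>t. a * reflection s u t + b * reflection s v t)"
  unfolding reflection_def B_lincomb[OF assms] by (auto simp: algebra_simps)

lemma reflection_simple_root:
  "reflection s (simple_root t) = (\<lambda>r. simple_root t r - 2 * form_coeff t s * simple_root s r)"
  by (simp add: reflection_def B_simple_simple)

lemma reflection_own_root: "s \<in> S \<Longrightarrow> reflection s (simple_root s) = (\<lambda>r. - simple_root s r)"
  by (simp add: reflection_simple_root form_coeff_refl)

lemma reflection_involution:
  assumes "s \<in> S" "v \<in> V"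
  shows "reflection s (reflection s v) = v"
proof -
  have "reflection s v = (\<lambda>t. 1 * v t + (- 2 * B v (simple_root s)) * simple_root s t)"
    by (simp add: reflection_def)
  then have "reflection s (reflection s v)
      = reflection s (\<lambda>t. 1 * v t + (- 2 * B v (simple_root s)) * simple_root s t)"
    by (rule arg_cong)
  also have "\<dots>
      = (\<lambda>t. 1 * reflection s v t + (- 2 * B v (simple_root s)) * reflection s (simple_root s) t)"
    by (rule reflection_lincomb[OF assms(2) simple_root_V[OF assms(1)]])
  finally have "reflection s (reflection s v)
      = (\<lambda>t. 1 * reflection s v t + (- 2 * B v (simple_root s)) * reflection s (simple_root s) t)" .
  then show ?thesis
    using assms by (auto simp: reflection_own_root) (auto simp: reflection_def)
qed

abbreviation word_reflection :: "'a list \<Rightarrow> ('a \<Rightarrow> real) \<Rightarrow> 'a \<Rightarrow> real" where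
  "word_reflection xs v \<equiv> foldr reflection xs v"

lemma word_reflection_V: "xs \<in> lists S \<Longrightarrow> v \<in> V \<Longrightarrow> word_reflection xs v \<in> V"
  by (induction xs) (auto simp: reflection_V)

lemma word_reflection_lincomb:
  assumes "xs \<in> lists S" "u \<in> V" "v \<in> V"
  shows "word_reflection xs (\<lambda>t. a * u t + b * v t)
    = (\<lambda>t. a * word_reflection xs u t + b * word_reflection xs v t)"
  using assms(1)
  by (induction xs) (auto simp: reflection_lincomb word_reflection_V assms)

text \<open>
  One more reflection replaces the pair of coefficients \<open>(c_(k+1), c_k)\<close> by \<open>(c_(k+2), c_(k+1))\<close>,
  which is the recursion of the dihedral coefficients. The larger index belongs to the
  reflection that was applied last.
\<close>

lemma word_reflection_alternating:
  assumes "s \<in> S" "t \<in> S"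
  shows "word_reflection (alternating_word k s t) (simple_root s) =
    (\<lambda>r. dihedral_coeff (- form_coeff s t) (Suc k) * simple_root (if even k then s else t) r
       + dihedral_coeff (- form_coeff s t) k * simple_root (if even k then t else s) r)"
proof (induction k)
  case (Suc k)
  have "word_reflection (alternating_word (Suc k) s t) (simple_root s)
    = reflection (if even k then t else s)
       (\<lambda>r. dihedral_coeff (- form_coeff s t) (Suc k) * simple_root (if even k then s else t) r
       + dihedral_coeff (- form_coeff s t) k * simple_root (if even k then t else s) r)"
    by (simp add: Suc.IH)
  also have "\<dots> = (\<lambda>r. dihedral_coeff (- form_coeff s t) (Suc k)
          * reflection (if even k then t else s) (simple_root (if even k then s else t)) r
       + dihedral_coeff (- form_coeff s t) k
          * reflection (if even k then t else s) (simple_root (if even k then t else s)) r)"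
    using assms by (intro reflection_lincomb) (auto simp: simple_root_V)
  also have "\<dots> = (\<lambda>r. dihedral_coeff (- form_coeff s t) (Suc (Suc k))
          * simple_root (if even (Suc k) then s else t) r
       + dihedral_coeff (- form_coeff s t) (Suc k)
          * simple_root (if even (Suc k) then t else s) r)"
    using assms form_coeff_sym[OF assms]
    by (auto simp: reflection_simple_root form_coeff_refl algebra_simps)
  finally show ?case .
qed auto

text \<open>
  The only case with content is \<open>s \<noteq> t\<close> with finite \<open>m = m s t\<close>. Then \<open>(r_s r_t)^m\<close> fixes both simple roots since the
  dihedral coefficients have period \<open>2 m\<close>, and it fixes every vector orthogonal to both. The form
  has determinant \<open>sin\<^sup>2 (\<pi> / m) > 0\<close> on the plane spanned by the two roots, so each vector is
  a sum of a vector of the plane and a vector orthogonal to it.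
\<close>

lemma word_reflection_braid:
  assumes st: "s \<in> S" "t \<in> S" and v: "v \<in> V"
  shows "word_reflection (concat (replicate (m s t) [s, t])) v = v"
proof -
  consider "s = t" | "m s t = 0" | "s \<noteq> t" "m s t \<noteq> 0" by blast
  then show ?thesis
  proof cases
    case 1
    then show ?thesis using st v by (simp add: m_refl reflection_involution)
  next
    case 2
    then show ?thesis by simp
  next
    case 3
    let ?w = "concat (replicate (m s t) [s, t])"
    let ?\<theta> = "pi / real (m s t)"
    let ?q = "cos ?\<theta>"
    have m2: "m s t \<ge> 2" using 3 st m_ge by blast
    have q: "- form_coeff s t = ?q" "- form_coeff t s = ?q"
      using 3 st by (auto simp: form_coeff_def m_sym)
    have sin: "sin ?\<theta> > 0"
      using m2 by (intro sin_gt_zero) (auto simp: field_simps)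
    have c: "dihedral_coeff ?q k = sin (real k * ?\<theta>) / sin ?\<theta>" for k
      using dihedral_coeff_cos[of ?\<theta> k] sin by (simp add: field_simps)
    have per: "real (2 * m s t) * ?\<theta> = 2 * pi" using 3 by simp
    have c0: "dihedral_coeff ?q (2 * m s t) = 0"
      unfolding c per by simp
    have "real (Suc (2 * m s t)) * ?\<theta> = ?\<theta> + 2 * pi"
      using per by (simp add: algebra_simps)
    then have c1: "dihedral_coeff ?q (Suc (2 * m s t)) = 1"
      unfolding c using sin by simp
    obtain j where j: "2 * m s t = Suc j" using 3 by (cases "2 * m s t") auto
    have "odd j" using j by presburger
    have "real j * ?\<theta> = 2 * pi - ?\<theta>"
      using per unfolding j by (simp add: algebra_simps add_divide_distrib)
    then have cj: "dihedral_coeff ?q j = - 1"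
      unfolding c using sin by (simp add: sin_diff)
    have w: "?w = alternating_word (2 * m s t) s t" by (simp add: alternating_word_even)
    have w': "?w = alternating_word j t s @ [t]" unfolding w j by (rule alternating_word_snoc)
    have wS: "?w \<in> lists S" by (rule replicate_pair_lists[OF st])
    have jS: "alternating_word j t s \<in> lists S" using st set_alternating_word[of j t s] by auto
    have fs: "word_reflection ?w (simple_root s) = simple_root s"
      unfolding w word_reflection_alternating[OF st] q c0 c1 by simp
    have ft: "word_reflection ?w (simple_root t) = simple_root t"
    proof -
      have "word_reflection ?w (simple_root t)
        = word_reflection (alternating_word j t s) (\<lambda>r. (- 1) * simple_root t r + 0 * simple_root t r)"
        unfolding w' using st by (simp add: reflection_own_root)
      also have "\<dots> = (\<lambda>r. - 1 * word_reflection (alternating_word j t s) (simple_root t) r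
          + 0 * word_reflection (alternating_word j t s) (simple_root t) r)"
        by (intro word_reflection_lincomb jS simple_root_V st)
      also have "\<dots> = simple_root t"
        unfolding word_reflection_alternating[OF st(2,1)] q cj j[symmetric] c0 using \<open>odd j\<close>
        by simp
      finally show ?thesis .
    qed
    have D: "1 - ?q\<^sup>2 > 0" using sin by (simp add: cos_squared_eq)
    \<comment> \<open>The vector \<open>p\<close> is the orthogonal projection of \<open>v\<close> to the plane; \<open>x\<close> and \<open>y\<close> solve the
      two linear equations for its coordinates by Cramer's rule.\<close>
    define a b where "a = B v (simple_root s)" and "b = B v (simple_root t)"
    define x where "x = (a + ?q * b) / (1 - ?q\<^sup>2)"
    define y where "y = (b + ?q * a) / (1 - ?q\<^sup>2)"
    define p where "p = (\<lambda>r. x * simple_root s r + y * simple_root t r)"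
    define u where "u = (\<lambda>r. 1 * v r + (- 1) * p r)"
    have pV: "p \<in> V" unfolding p_def by (intro V_lincomb simple_root_V st)
    have uV: "u \<in> V" unfolding u_def by (intro V_lincomb v pV)
    have wp: "word_reflection ?w p = p"
      unfolding p_def word_reflection_lincomb[OF wS simple_root_V[OF st(1)] simple_root_V[OF st(2)]]
        fs ft ..
    have xy: "x - ?q * y = a" "y - ?q * x = b"
    proof -
      have "x - ?q * y = (a * (1 - ?q\<^sup>2)) / (1 - ?q\<^sup>2)"
        unfolding x_def y_def times_divide_eq_right diff_divide_distrib[symmetric]
        by (simp add: algebra_simps power2_eq_square)
      then show "x - ?q * y = a" using D by simp
      have "y - ?q * x = (b * (1 - ?q\<^sup>2)) / (1 - ?q\<^sup>2)"
        unfolding x_def y_def times_divide_eq_right diff_divide_distrib[symmetric]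
        by (simp add: algebra_simps power2_eq_square)
      then show "y - ?q * x = b" using D by simp
    qed
    have q': "form_coeff s t = - ?q" "form_coeff t s = - ?q" using q by auto
    have Bp: "B p (simple_root r) = x * form_coeff s r + y * form_coeff t r" for r
      unfolding p_def B_lincomb[OF simple_root_V[OF st(1)] simple_root_V[OF st(2)]]
        B_simple_simple ..
    have Bu: "B u (simple_root r) = B v (simple_root r) - B p (simple_root r)" for r
      unfolding u_def B_lincomb[OF v pV] by simp
    have "B u (simple_root s) = 0" "B u (simple_root t) = 0"
      unfolding Bu Bp q' form_coeff_refl[OF st(1)] form_coeff_refl[OF st(2)]
        a_def[symmetric] b_def[symmetric] using xy by (simp_all add: mult.commute)
    then have ru: "reflection s u = u" "reflection t u = u" by (auto simp: reflection_def)
    have wu: "word_reflection (concat (replicate k [s, t])) u = u" for k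
      by (induction k) (auto simp: ru)
    have vu: "v = (\<lambda>r. 1 * u r + 1 * p r)" by (simp add: u_def)
    show ?thesis
      by (subst (1 2) vu) (simp only: word_reflection_lincomb[OF wS uV pV] wu wp)
  qed
qed

lemma word_reflection_equiv:
  assumes "word_equiv S m xs ys" "v \<in> V"
  shows "word_reflection xs v = word_reflection ys v"
  using assms
proof (induction arbitrary: v rule: word_equiv.induct)
  case (relator us vs s t)
  then have "word_reflection (concat (replicate (m s t) [s, t])) (word_reflection vs v)
      = word_reflection vs v"
    by (intro word_reflection_braid word_reflection_V)
  then show ?case by simp
qed auto

lemma word_prod_closed [simp]: "xs \<in> lists S \<Longrightarrow> word_prod W xs \<in> carrier W"
  using S_subset by (induction xs) (auto simp: word_prod_def)

lemma word_prod_append: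
  assumes "xs \<in> lists S" "ys \<in> lists S"
  shows "word_prod W (xs @ ys) = word_prod W xs \<otimes> word_prod W ys"
  using assms(1)
proof (induction xs)
  case Nil
  then show ?case using word_prod_closed[OF assms(2)] by (simp add: word_prod_def)
next
  case (Cons x xs)
  then have "x \<in> carrier W" using S_subset by auto
  with Cons show ?case
    using word_prod_closed[OF assms(2)] word_prod_closed[OF Cons.hyps(2)]
    by (simp add: word_prod_def m_assoc)
qed

lemma word_prod_Nil [simp]: "word_prod W [] = \<one>"
  and word_prod_Cons [simp]: "word_prod W (x # xs) = x \<otimes> word_prod W xs"
  by (auto simp: word_prod_def)

lemma S_carrier [simp]: "s \<in> S \<Longrightarrow> s \<in> carrier W"
  using S_subset by auto

lemma braid_relation:
  assumes "s \<in> S" "t \<in> S"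
  shows "(s \<otimes> t) [^] m s t = \<one>"
proof -
  have "word_equiv S m ([] @ concat (replicate (m s t) [s, t]) @ []) ([] @ [])"
    using assms by (intro word_equiv.relator) auto
  then have "word_prod W (concat (replicate (m s t) [s, t])) = word_prod W []"
    using presentation[OF replicate_pair_lists[OF assms] lists.Nil] by simp
  moreover have "word_prod W (concat (replicate k [s, t])) = (s \<otimes> t) [^] k" for k
  proof (induction k)
    case (Suc k)
    have "(s \<otimes> t) [^] Suc k = (s \<otimes> t) \<otimes> (s \<otimes> t) [^] k"
      using assms by (intro nat_pow_Suc2) auto
    then show ?case using assms Suc by (simp add: m_assoc)
  qed simp
  ultimately show ?thesis by simp
qed

lemma generator_square: "s \<in> S \<Longrightarrow> s \<otimes> s = \<one>"
  using braid_relation[of s s] by (simp add: m_refl)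

lemma generator_inv: "s \<in> S \<Longrightarrow> inv s = s"
  using generator_square by (simp add: inv_equality)

lemma generator_cancel: "s \<in> S \<Longrightarrow> x \<in> carrier W \<Longrightarrow> x \<otimes> s \<otimes> s = x"
  by (simp add: m_assoc generator_square)

lemma word_exists:
  assumes "w \<in> carrier W"
  shows "\<exists>xs \<in> lists S. word_prod W xs = w"
proof -
  have "w \<in> generate W S" using assms generates by simp
  then show ?thesis
  proof induction
    case one
    show ?case by (intro bexI[of _ "[]"]) auto
  next
    case (incl h)
    then show ?case by (intro bexI[of _ "[h]"]) auto
  next
    case (inv h)
    then show ?case by (intro bexI[of _ "[h]"]) (auto simp: generator_inv)
  next
    case (eng g h)
    then obtain xs ys where "xs \<in> lists S" "ys \<in> lists S" "word_prod W xs = g" "word_prod W ys = h"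
      by blast
    then show ?case by (intro bexI[of _ "xs @ ys"]) (auto simp: word_prod_append)
  qed
qed

text \<open>
  An element of the group acts through any word that represents it. This does not depend on the
  word, because the presentation turns equality in \<open>W\<close> into equivalence of words, and equivalent
  words act alike.
\<close>

lemma geometric_action_exists:
  "\<exists>\<phi>. group_action W V \<phi> \<and> (\<forall>s\<in>S. \<forall>v\<in>V. \<phi> s v = reflection s v)"
proof -
  define wd where "wd w = (SOME xs. xs \<in> lists S \<and> word_prod W xs = w)" for w
  have wd: "wd w \<in> lists S \<and> word_prod W (wd w) = w" if "w \<in> carrier W" for w
    unfolding wd_def by (rule someI_ex) (use word_exists[OF that] in blast)
  define \<phi> where "\<phi> w = (\<lambda>v\<in>V. word_reflection (wd w) v)" for w
  have eq: "word_reflection (wd (word_prod W xs)) v = word_reflection xs v"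
    if "xs \<in> lists S" "v \<in> V" for xs v
    using wd[of "word_prod W xs"] word_prod_closed[OF that(1)] that
      presentation[of "wd (word_prod W xs)" xs] word_reflection_equiv by blast
  have mult: "\<phi> (x \<otimes> y) v = \<phi> x (\<phi> y v)" if "x \<in> carrier W" "y \<in> carrier W" "v \<in> V" for x y v
  proof -
    have "word_prod W (wd x @ wd y) = x \<otimes> y" using wd that by (simp add: word_prod_append)
    then have "word_reflection (wd (x \<otimes> y)) v = word_reflection (wd x @ wd y) v"
      using eq[of "wd x @ wd y" v] wd that by simp
    then show ?thesis using wd that by (simp add: \<phi>_def word_reflection_V)
  qed
  have one: "\<phi> \<one> v = v" if "v \<in> V" for v
    using eq[of "[]" v] that by (simp add: \<phi>_def)
  have closed: "\<phi> x v \<in> V" if "x \<in> carrier W" "v \<in> V" for x v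
    using wd that by (simp add: \<phi>_def word_reflection_V)
  have bij: "\<phi> x \<in> Bij V" if "x \<in> carrier W" for x
  proof -
    have "bij_betw (\<phi> x) V V"
      by (rule bij_betw_byWitness[of _ "\<phi> (inv x)"])
         (use that in \<open>auto simp: mult[symmetric] one closed\<close>)
    then show ?thesis by (simp add: Bij_def \<phi>_def)
  qed
  have "group_hom W (BijGroup V) \<phi>"
  proof (intro group_hom.intro group_hom_axioms.intro is_group group_BijGroup homI)
    fix x y assume xy: "x \<in> carrier W" "y \<in> carrier W"
    show "\<phi> x \<in> carrier (BijGroup V)" using bij xy by (simp add: BijGroup_def)
    show "\<phi> (x \<otimes> y) = \<phi> x \<otimes>\<^bsub>BijGroup V\<^esub> \<phi> y"
      using xy bij mult by (auto simp: BijGroup_def compose_def \<phi>_def[of "x \<otimes> y"] fun_eq_iff)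
         (auto simp: \<phi>_def)
  qed
  moreover have "\<phi> s v = reflection s v" if "s \<in> S" "v \<in> V" for s v
    using eq[of "[s]" v] that by (simp add: \<phi>_def)
  ultimately show ?thesis by (auto simp: group_action_def)
qed

lemma act_group_action: "group_action W V act"
  and act_generator: "s \<in> S \<Longrightarrow> v \<in> V \<Longrightarrow> act s v = reflection s v"
  using someI_ex[OF geometric_action_exists] unfolding act_def by auto

lemma act_mult: "x \<in> carrier W \<Longrightarrow> y \<in> carrier W \<Longrightarrow> v \<in> V \<Longrightarrow> act (x \<otimes> y) v = act x (act y v)"
  using group_action.composition_rule[OF act_group_action] by blast

lemma act_V: "x \<in> carrier W \<Longrightarrow> v \<in> V \<Longrightarrow> act x v \<in> V"
  using group_action.element_image[OF act_group_action] by blast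

lemma act_one: "v \<in> V \<Longrightarrow> act \<one> v = v"
  using group_action.id_eq_one[OF act_group_action] by (metis restrict_apply')

lemma act_inv: "x \<in> carrier W \<Longrightarrow> v \<in> V \<Longrightarrow> act (inv x) (act x v) = v"
  and act_inv': "x \<in> carrier W \<Longrightarrow> v \<in> V \<Longrightarrow> act x (act (inv x) v) = v"
  by (simp_all add: act_mult[symmetric] act_one)

lemma act_word_prod:
  "xs \<in> lists S \<Longrightarrow> v \<in> V \<Longrightarrow> act (word_prod W xs) v = word_reflection xs v"
  by (induction xs)
     (auto simp: act_one act_mult act_generator word_reflection_V)

lemma act_lincomb:
  assumes "x \<in> carrier W" "u \<in> V" "v \<in> V"
  shows "act x (\<lambda>t. a * u t + b * v t) = (\<lambda>t. a * act x u t + b * act x v t)"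
proof -
  obtain xs where "xs \<in> lists S" "word_prod W xs = x" using word_exists assms(1) by blast
  then show ?thesis
    using act_word_prod[of xs, symmetric] word_reflection_lincomb[of xs u v a b] V_lincomb[of u v a b]
      assms(2,3) by (simp add: act_word_prod)
qed

lemma act_neg:
  assumes "x \<in> carrier W" "v \<in> V"
  shows "act x (\<lambda>t. - v t) = (\<lambda>t. - act x v t)"
  using act_lincomb[OF assms assms(2), of "-1" 0] by simp

lemma act_expand:
  assumes x: "x \<in> carrier W" and v: "v \<in> V" and F: "finite F" "{s. v s \<noteq> 0} \<subseteq> F" "F \<subseteq> S"
  shows "act x v t = (\<Sum>s\<in>F. v s * act x (simple_root s) t)"
  using F v
proof (induction F arbitrary: v rule: finite_induct)
  case empty
  then have "v = (\<lambda>t. 0)" by auto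
  then show ?case using act_lincomb[OF x empty(3,3), of 0 0] by simp
next
  case (insert s F)
  define u where "u = v(s := 0)"
  have "{t. u t \<noteq> 0} \<subseteq> {t. v t \<noteq> 0}" by (auto simp: u_def)
  then have uV: "u \<in> V" using insert.prems by (auto simp: V_def intro: finite_subset)
  have sV: "simple_root s \<in> V" using insert.prems simple_root_V by simp
  have "v = (\<lambda>t. 1 * u t + v s * simple_root s t)" by (auto simp: u_def simple_root_def)
  then have "act x v = act x (\<lambda>t. 1 * u t + v s * simple_root s t)" by (rule arg_cong)
  then have "act x v t = 1 * act x u t + v s * act x (simple_root s) t"
    by (simp only: act_lincomb[OF x uV sV])
  also have "act x u t = (\<Sum>r\<in>F. u r * act x (simple_root r) t)"
    using insert.prems by (intro insert.IH uV) (auto simp: u_def)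
  also have "\<dots> = (\<Sum>r\<in>F. v r * act x (simple_root r) t)"
    using insert.hyps by (intro sum.cong) (auto simp: u_def)
  finally show ?case using insert.hyps by simp
qed

section \<open>Length and the signs of roots\<close>

definition len :: "'a \<Rightarrow> nat" where
  "len w = (LEAST k. \<exists>xs \<in> lists S. length xs = k \<and> word_prod W xs = w)"

lemma len_le: "xs \<in> lists S \<Longrightarrow> len (word_prod W xs) \<le> length xs"
  unfolding len_def by (rule Least_le) auto

lemma reduced_word_exists:
  assumes "w \<in> carrier W"
  shows "\<exists>xs \<in> lists S. length xs = len w \<and> word_prod W xs = w"
  unfolding len_def by (rule LeastI_ex) (use word_exists[OF assms] in blast)

lemma len_mult_word:
  assumes "w \<in> carrier W" "xs \<in> lists S"
  shows "len (w \<otimes> word_prod W xs) \<le> len w + length xs"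
proof -
  obtain ys where "ys \<in> lists S" "length ys = len w" "word_prod W ys = w"
    using reduced_word_exists assms by blast
  then show ?thesis using len_le[of "ys @ xs"] assms by (simp add: word_prod_append)
qed

lemma alternating_word_lists: "s \<in> S \<Longrightarrow> t \<in> S \<Longrightarrow> alternating_word k s t \<in> lists S"
  using set_alternating_word[of k s t] by auto

text \<open>
  The first half of the power is inverse to the alternating product on its left, and its second half
  is the alternating product that ends in \<open>s\<close>. For \<open>k = m s t\<close> the power is trivial, which gives the
  braid relation.
\<close>

lemma alternating_prod_swap:
  assumes "s \<in> S" "t \<in> S"
  shows "word_prod W (alternating_word k s t) \<otimes> (t \<otimes> s) [^] k = word_prod W (alternating_word k t s)"
  using assms
proof (induction k arbitrary: s t)
  case (Suc k)
  note st = Suc.prems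
  let ?p = "\<lambda>k s t. word_prod W (alternating_word k s t)"
  have p: "?p k s t \<in> carrier W" if "s \<in> S" "t \<in> S" for s t k
    using alternating_word_lists that by (intro word_prod_closed) blast
  have snoc: "?p (Suc k) s t = ?p k t s \<otimes> t" if "s \<in> S" "t \<in> S" for s t
    unfolding alternating_word_snoc using that
    by (subst word_prod_append) (auto simp: alternating_word_lists)
  have comm: "s \<otimes> (t \<otimes> s) [^] j = (s \<otimes> t) [^] j \<otimes> s" for j :: nat
  proof (induction j)
    case (Suc j)
    have "s \<otimes> (t \<otimes> s) [^] Suc j = (s \<otimes> (t \<otimes> s) [^] j) \<otimes> (t \<otimes> s)"
      using st by (simp add: m_assoc)
    also have "\<dots> = ((s \<otimes> t) [^] j \<otimes> s) \<otimes> (t \<otimes> s)" by (simp only: Suc)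
    also have "\<dots> = (s \<otimes> t) [^] Suc j \<otimes> s" using st by (simp add: m_assoc)
    finally show ?case .
  qed (use st in simp)
  have "?p (Suc k) s t \<otimes> (t \<otimes> s) [^] Suc k
      = ?p k t s \<otimes> t \<otimes> ((t \<otimes> s) \<otimes> (t \<otimes> s) [^] k)"
    unfolding snoc[OF st] using st nat_pow_Suc2[of "t \<otimes> s" k] by simp
  also have "\<dots> = ?p k t s \<otimes> ((t \<otimes> t) \<otimes> (s \<otimes> (t \<otimes> s) [^] k))"
    using st p by (simp add: m_assoc)
  also have "\<dots> = ?p k t s \<otimes> ((s \<otimes> t) [^] k \<otimes> s)"
    using st by (simp add: generator_square comm)
  also have "\<dots> = ?p k s t \<otimes> s"
    using Suc.IH[OF st(2,1)] st p by (simp add: m_assoc[symmetric])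
  also have "\<dots> = ?p (Suc k) t s" by (simp only: snoc[OF st(2,1)])
  finally show ?case .
qed auto

lemma alternating_prod_braid:
  assumes "s \<in> S" "t \<in> S"
  shows "word_prod W (alternating_word (m s t) s t) = word_prod W (alternating_word (m s t) t s)"
proof -
  have "word_prod W (alternating_word (m s t) s t) \<in> carrier W"
    using alternating_word_lists assms by (intro word_prod_closed) blast
  then show ?thesis
    using alternating_prod_swap[OF assms, of "m s t"] braid_relation[OF assms(2,1)] m_sym[OF assms]
    by simp
qed

text \<open>
  Up to index \<open>m\<close> the angles \<open>k \<pi> / m\<close> stay in \<open>[0, \<pi>]\<close>, where the sine is nonnegative. This is
  where it matters that the form takes the value \<open>- cos (\<pi> / m)\<close> and not the cosine of another
  angle.
\<close>

lemma dihedral_coeff_nonneg: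
  assumes "s \<in> S" "t \<in> S" "s \<noteq> t" "m s t = 0 \<or> k \<le> m s t"
  shows "dihedral_coeff (- form_coeff s t) k \<ge> 0"
proof (cases "m s t = 0")
  case True
  then show ?thesis by (simp add: form_coeff_def dihedral_coeff_one)
next
  case False
  let ?\<theta> = "pi / real (m s t)"
  have m2: "m s t \<ge> 2" using False assms m_ge by blast
  have sin: "sin ?\<theta> > 0" using m2 by (intro sin_gt_zero) (auto simp: field_simps)
  have "sin (real k * ?\<theta>) \<ge> 0"
    using assms False by (intro sin_ge_zero) (auto simp: field_simps)
  then have "dihedral_coeff (cos ?\<theta>) k * sin ?\<theta> \<ge> 0" by (simp only: dihedral_coeff_cos)
  then show ?thesis using sin False by (simp add: form_coeff_def zero_le_mult_iff)
qed

text \<open>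
  The proof reduces to rank two. Let \<open>t\<close> be the last letter of a reduced word of \<open>w\<close>, and split off
  from \<open>w\<close> the longest possible alternating suffix in \<open>s\<close> and \<open>t\<close> that ends in \<open>t\<close>, in such a way
  that lengths add: \<open>w = v p\<close>. The suffix takes \<open>\<alpha>_s\<close> to a combination of \<open>\<alpha>_s\<close> and \<open>\<alpha>_t\<close>, whose
  coefficients are nonnegative if the suffix has fewer than \<open>m s t\<close> letters. Neither \<open>s\<close> nor \<open>t\<close>
  makes the shorter element \<open>v\<close> shorter, so induction applies to \<open>v (\<alpha>_s)\<close> and \<open>v (\<alpha>_t)\<close>.
\<close>

lemma act_simple_root_nonneg:
  assumes "w \<in> carrier W" "s \<in> S" "len w \<le> len (w \<otimes> s)"
  shows "act w (simple_root s) r \<ge> 0"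
  using assms
proof (induction "len w" arbitrary: w s r rule: less_induct)
  case less
  note w = less.prems(1) and s = less.prems(2)
  obtain xs where xs: "xs \<in> lists S" "length xs = len w" "word_prod W xs = w"
    using reduced_word_exists w by blast
  show ?case
  proof (cases xs rule: rev_cases)
    case Nil
    then have "w = \<one>" using xs by simp
    then show ?thesis using s by (simp add: act_one simple_root_V) (simp add: simple_root_def)
  next
    case (snoc ys t)
    have t: "t \<in> S" and ys: "ys \<in> lists S" using xs snoc by auto
    have ysC: "word_prod W ys \<in> carrier W" using ys by (rule word_prod_closed)
    have wt: "w = word_prod W ys \<otimes> t"
      using xs(3) snoc ys t by (simp add: word_prod_append)
    have len_ys: "Suc (len (word_prod W ys)) \<le> len w"
      using len_le[OF ys] snoc xs(2) by simp
    let ?p = "\<lambda>k s t. word_prod W (alternating_word k s t)"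
    have pC: "?p k s t \<in> carrier W" if "s \<in> S" "t \<in> S" for s t k
      using alternating_word_lists that by (intro word_prod_closed) blast
    have st: "s \<noteq> t"
    proof
      assume "s = t"
      then have "w \<otimes> s = word_prod W ys" using wt t ysC by (simp add: generator_cancel)
      then show False using less.prems(3) len_ys by simp
    qed
    \<comment> \<open>The inequality in \<open>Q\<close> is an equality, since the other direction always holds.\<close>
    define Q where "Q k \<longleftrightarrow> (\<exists>v \<in> carrier W. w = v \<otimes> ?p k s t \<and> len v + k \<le> len w)" for k
    have Q1: "Q 1"
      unfolding Q_def using wt ysC len_ys t by (intro bexI[of _ "word_prod W ys"]) auto
    have bound: "k \<le> len w" if "Q k" for k using that unfolding Q_def by auto
    define k where "k = (GREATEST k. Q k)"
    have Qk: "Q k" unfolding k_def by (rule GreatestI_nat[of Q, OF Q1]) (use bound in blast)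
    have kmax: "j \<le> k" if "Q j" for j
      unfolding k_def by (rule Greatest_le_nat[of Q, OF that]) (use bound in blast)
    have k1: "k \<ge> 1" using kmax Q1 by blast
    obtain v where v: "v \<in> carrier W" "w = v \<otimes> ?p k s t" "len v + k \<le> len w"
      using Qk unfolding Q_def by blast
    \<comment> \<open>Otherwise this letter could be moved from the end of \<open>v\<close> to the suffix, against maximality.\<close>
    have next_letter: "len v \<le> len (v \<otimes> (if even k then t else s))"
    proof (rule ccontr)
      let ?r = "if even k then t else s"
      assume "\<not> ?thesis"
      moreover have "w = (v \<otimes> ?r) \<otimes> ?p (Suc k) s t"
      proof -
        have "(v \<otimes> ?r) \<otimes> ?p (Suc k) s t = v \<otimes> ?r \<otimes> ?r \<otimes> ?p k s t"
          using v(1) s t pC[OF s t] by (simp add: m_assoc)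
        then show ?thesis using v s t by (simp add: generator_cancel)
      qed
      ultimately have "Q (Suc k)"
        unfolding Q_def using v s t by (intro bexI[of _ "v \<otimes> ?r"]) auto
      then show False using kmax by fastforce
    qed
    \<comment> \<open>Otherwise a word of \<open>v\<close> ending in the first letter of the suffix would cancel against it,
      which gives a word of \<open>w\<close> that is too short.\<close>
    have first_letter: "len v \<le> len (v \<otimes> (if even k then s else t))"
    proof (rule ccontr)
      let ?r = "if even k then s else t"
      assume neg: "\<not> ?thesis"
      obtain j where j: "k = Suc j" using k1 by (cases k) auto
      have "w = v \<otimes> (?r \<otimes> ?p j s t)" using v(2) unfolding j by simp
      then have "w = (v \<otimes> ?r) \<otimes> ?p j s t" using v(1) s t pC[OF s t] by (simp add: m_assoc)
      then have "len w \<le> len (v \<otimes> ?r) + j"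
        using len_mult_word[of "v \<otimes> ?r" "alternating_word j s t"] v(1) s t alternating_word_lists
        by simp
      then show False using neg v(3) j by simp
    qed
    have lt: "len v < len w" using v(3) k1 by simp
    have "len v \<le> len (v \<otimes> s)" "len v \<le> len (v \<otimes> t)"
      using next_letter first_letter by (auto split: if_splits)
    then have pos: "act v (simple_root s) r \<ge> 0" "act v (simple_root t) r \<ge> 0"
      using less.hyps[OF lt v(1)] s t by auto
    \<comment> \<open>A suffix with \<open>m s t\<close> letters or more could be rewritten by the braid relation to end in \<open>s\<close>,
      and then \<open>w \<otimes> s\<close> would be shorter than \<open>w\<close>.\<close>
    have km: "m s t = 0 \<or> Suc k \<le> m s t"
    proof (rule ccontr)
      assume "\<not> ?thesis"
      then obtain i j where ij: "m s t = Suc i" "k = j + Suc i"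
        by (metis add.commute le_add_diff_inverse not0_implies_Suc not_less_eq_eq)
      define zs where "zs = take j (alternating_word k s t)"
      have zs: "alternating_word k s t = zs @ alternating_word (Suc i) s t"
        unfolding zs_def ij(2) by (rule alternating_word_split)
      have zsS: "zs \<in> lists S" unfolding zs_def
        using alternating_word_lists[OF s t, of k] by (auto dest: in_set_takeD)
      have lz: "length zs = j" unfolding zs_def by (simp add: ij)
      have zsC: "word_prod W zs \<in> carrier W" using zsS by (rule word_prod_closed)
      have "?p (Suc i) s t = ?p i s t \<otimes> s"
        using alternating_prod_braid[OF s t] unfolding ij(1) alternating_word_snoc[of i t s]
        using s t by (simp add: word_prod_append alternating_word_lists del: alternating_word.simps)
      moreover have "?p k s t = word_prod W zs \<otimes> ?p (Suc i) s t"
        unfolding zs by (intro word_prod_append zsS alternating_word_lists s t)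
      ultimately have "w = v \<otimes> word_prod W zs \<otimes> ?p i s t \<otimes> s"
        using v zsC pC[OF s t] s by (simp add: m_assoc)
      then have "w \<otimes> s = v \<otimes> word_prod W zs \<otimes> ?p i s t"
        using generator_cancel s v(1) zsC pC[OF s t] by simp
      also have "\<dots> = v \<otimes> word_prod W (zs @ alternating_word i s t)"
        using v(1) zsC pC[OF s t] zsS alternating_word_lists[OF s t]
        by (simp add: word_prod_append m_assoc)
      finally have "len (w \<otimes> s) \<le> len v + (j + i)"
        using len_mult_word[OF v(1), of "zs @ alternating_word i s t"] zsS
          alternating_word_lists[OF s t] lz by simp
      then show False using less.prems(3) v(3) ij by simp
    qed
    let ?c = "\<lambda>k. dihedral_coeff (- form_coeff s t) k"
    have c: "?c (Suc k) \<ge> 0" "?c k \<ge> 0"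
      using dihedral_coeff_nonneg[OF s t st] km by auto
    have "act w (simple_root s) = act v (word_reflection (alternating_word k s t) (simple_root s))"
      using v(1,2) pC[OF s t] s t
      by (simp add: act_mult act_word_prod simple_root_V alternating_word_lists)
    also have "\<dots> = (\<lambda>r. ?c (Suc k) * act v (simple_root (if even k then s else t)) r
       + ?c k * act v (simple_root (if even k then t else s)) r)"
      unfolding word_reflection_alternating[OF s t]
      using v(1) s t by (intro act_lincomb) (auto simp: simple_root_V)
    finally show ?thesis using c pos by auto
  qed
qed

lemma roots_V: "\<beta> \<in> roots \<Longrightarrow> \<beta> \<in> V"
  by (auto simp: roots_def act_V simple_root_V)

lemma act_roots: "x \<in> carrier W \<Longrightarrow> \<beta> \<in> roots \<Longrightarrow> act x \<beta> \<in> roots"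
  by (auto simp: roots_def act_mult[symmetric] simple_root_V) (use m_closed in blast)

lemma simple_root_roots: "s \<in> S \<Longrightarrow> simple_root s \<in> roots"
  using act_one[OF simple_root_V] by (force simp: roots_def)

lemma uminus_roots: "\<beta> \<in> roots \<Longrightarrow> (\<lambda>t. - \<beta> t) \<in> roots"
proof -
  assume "\<beta> \<in> roots"
  then obtain w s where ws: "w \<in> carrier W" "s \<in> S" "\<beta> = act w (simple_root s)"
    by (auto simp: roots_def)
  have "act (w \<otimes> s) (simple_root s) = (\<lambda>t. - \<beta> t)"
    using ws by (simp add: act_mult simple_root_V act_generator reflection_own_root act_neg)
  then show ?thesis using ws unfolding roots_def by (metis (mono_tags, lifting) mem_Collect_eq m_closed S_carrier)
qed

lemma root_nonzero:
  assumes "\<beta> \<in> roots"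
  shows "\<exists>t. \<beta> t \<noteq> 0"
proof (rule ccontr)
  assume "\<not> ?thesis"
  then have z: "\<beta> = (\<lambda>t. 0)" by auto
  obtain w s where ws: "w \<in> carrier W" "s \<in> S" "\<beta> = act w (simple_root s)"
    using assms by (auto simp: roots_def)
  have "act (inv w) (\<lambda>t. 0) = (\<lambda>t. 0)"
    using act_lincomb[of "inv w" \<beta> \<beta> 0 0] ws(1) roots_V[OF assms] by simp
  moreover have "act (inv w) (\<lambda>t. 0) = simple_root s"
    using act_inv[OF ws(1) simple_root_V[OF ws(2)]] ws(3) z by simp
  ultimately show False by (auto simp: simple_root_def fun_eq_iff dest: spec[of _ s])
qed

text \<open>
  Either \<open>w\<close> does not get shorter when multiplied by \<open>s\<close>, or \<open>w s\<close> does not; the two elements take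
  \<open>\<alpha>_s\<close> to opposite vectors.
\<close>

lemma root_sign:
  assumes "\<beta> \<in> roots"
  shows "(\<forall>t. 0 \<le> \<beta> t) \<or> (\<forall>t. \<beta> t \<le> 0)"
proof -
  obtain w s where ws: "w \<in> carrier W" "s \<in> S" "\<beta> = act w (simple_root s)"
    using assms by (auto simp: roots_def)
  show ?thesis
  proof (cases "len w \<le> len (w \<otimes> s)")
    case True
    then show ?thesis using act_simple_root_nonneg ws by blast
  next
    case False
    have "act (w \<otimes> s) (simple_root s) = (\<lambda>t. - \<beta> t)"
      using ws by (simp add: act_mult simple_root_V act_generator reflection_own_root act_neg)
    moreover have "0 \<le> act (w \<otimes> s) (simple_root s) t" for t
      using False ws by (intro act_simple_root_nonneg) (auto simp: generator_cancel)
    ultimately show ?thesis by auto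
  qed
qed

lemma pos_root_iff:
  assumes "\<beta> \<in> roots"
  shows "\<beta> \<in> pos_roots \<longleftrightarrow> (\<forall>t. 0 \<le> \<beta> t)"
proof -
  have "0 \<le> \<beta> t" if "\<forall>s\<in>S. 0 \<le> \<beta> s" for t
    using that V_outside[OF roots_V[OF assms]] by (cases "t \<in> S") auto
  then show ?thesis using assms by (auto simp: pos_roots_def)
qed

text \<open>
  By sign coherence a single nonzero coordinate decides the sign of a root. So a group element that
  leaves such a coordinate unchanged also keeps the sign.
\<close>

lemma pos_root_coord:
  assumes "\<beta> \<in> roots" "\<beta> t \<noteq> 0"
  shows "\<beta> \<in> pos_roots \<longleftrightarrow> \<beta> t > 0"
  using root_sign[OF assms(1)] assms(2) unfolding pos_root_iff[OF assms(1)]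
  by (metis less_eq_real_def not_less)

lemma neg_roots_iff_uminus: "\<beta> \<in> neg_roots \<longleftrightarrow> (\<lambda>t. - \<beta> t) \<in> pos_roots"
  unfolding neg_roots_def by force

lemma neg_root_iff:
  assumes "\<beta> \<in> roots"
  shows "\<beta> \<in> neg_roots \<longleftrightarrow> \<beta> \<notin> pos_roots"
proof -
  obtain t where t: "\<beta> t \<noteq> 0" using root_nonzero assms by blast
  have "\<beta> \<in> neg_roots \<longleftrightarrow> (\<lambda>t. - \<beta> t) \<in> pos_roots"
    by (rule neg_roots_iff_uminus)
  also have "\<dots> \<longleftrightarrow> \<beta> \<notin> pos_roots"
    using pos_root_coord[OF uminus_roots[OF assms], of t] pos_root_coord[OF assms t] t by auto
  finally show ?thesis .
qed

lemma inversions_iff: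
  assumes "w \<in> carrier W"
  shows "\<beta> \<in> inversions w \<longleftrightarrow> \<beta> \<in> roots \<and> \<beta> \<in> pos_roots \<and> act (inv w) \<beta> \<notin> pos_roots"
  using assms neg_root_iff[OF act_roots[of "inv w" \<beta>]] by (auto simp: inversions_def pos_roots_def)

text \<open>
  Group elements permute the roots, so equality of the image of a set with another one can be
  tested root by root, without exhibiting preimages.
\<close>

lemma act_image_eq:
  assumes "x \<in> carrier W" "A \<subseteq> roots" "C \<subseteq> roots"
    and "\<And>\<beta>. \<beta> \<in> roots \<Longrightarrow> \<beta> \<in> A \<longleftrightarrow> act x \<beta> \<in> C"
  shows "act x ` A = C"
proof
  show "act x ` A \<subseteq> C" using assms by blast
  show "C \<subseteq> act x ` A"
  proof
    fix \<gamma> assume \<gamma>: "\<gamma> \<in> C"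
    then have r: "\<gamma> \<in> roots" using assms by blast
    then have "act x (act (inv x) \<gamma>) = \<gamma>" using assms(1) by (simp add: act_inv' roots_V)
    moreover have "act (inv x) \<gamma> \<in> roots" using r assms(1) by (simp add: act_roots)
    ultimately show "\<gamma> \<in> act x ` A" using assms(4) \<gamma> by (metis imageI)
  qed
qed

section \<open>Longest elements of parabolic subgroups\<close>

lemma parabolic_carrier: "J \<subseteq> S \<Longrightarrow> x \<in> generate W J \<Longrightarrow> x \<in> carrier W"
  using generate_in_carrier S_subset by (metis order_trans)

lemma parabolic_inv: "J \<subseteq> S \<Longrightarrow> x \<in> generate W J \<Longrightarrow> inv x \<in> generate W J"
  using generate_m_inv_closed S_subset by (metis order_trans)

text \<open>
  The reflection in \<open>\<alpha>_s\<close> changes only the coordinate of \<open>s\<close>.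
\<close>

lemma parabolic_coord:
  assumes "x \<in> generate W J" "J \<subseteq> S" "v \<in> V" "t \<notin> J"
  shows "act x v t = v t"
  using assms(1,3)
proof (induction arbitrary: v)
  case (incl h)
  then show ?case using assms by (auto simp: act_generator reflection_def simple_root_def)
next
  case (inv h)
  then show ?case
    using assms by (auto simp: generator_inv subset_iff act_generator reflection_def simple_root_def)
next
  case (eng g h)
  then show ?case using parabolic_carrier[OF assms(2)] by (simp add: act_mult act_V)
qed (simp add: act_one)

text \<open>
  An element \<open>w\<close> of maximal length in the parabolic subgroup works: \<open>w s\<close> is not longer than \<open>w\<close>,
  hence \<open>w s (\<alpha>_s) = - w (\<alpha>_s)\<close> is nonnegative.
\<close>

lemma longest_element_exists:
  assumes "finite (carrier W)" "J \<subseteq> S"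
  shows "\<exists>w \<in> generate W J. \<forall>s\<in>J. \<forall>t. act w (simple_root s) t \<le> 0"
proof -
  let ?G = "generate W J"
  have fin: "finite ?G" using assms parabolic_carrier by (meson finite_subset subsetI)
  have "?G \<noteq> {}" using generate.one by blast
  then have "Max (len ` ?G) \<in> len ` ?G" using fin by simp
  then obtain w where w: "w \<in> ?G" "len w = Max (len ` ?G)" by auto
  have wC: "w \<in> carrier W" using w assms parabolic_carrier by blast
  have "act w (simple_root s) t \<le> 0" if s: "s \<in> J" for s t
  proof -
    have sS: "s \<in> S" using s assms by blast
    have "w \<otimes> s \<in> ?G" using generate.eng[OF w(1) generate.incl[OF s]] .
    then have "len (w \<otimes> s) \<le> len w" unfolding w(2) using fin by simp
    then have "0 \<le> act (w \<otimes> s) (simple_root s) t"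
      using wC sS by (intro act_simple_root_nonneg) (auto simp: generator_cancel)
    then show ?thesis
      using wC sS by (simp add: act_mult simple_root_V act_generator reflection_own_root act_neg)
  qed
  then show ?thesis using w(1) by blast
qed

text \<open>
  A positive root supported in \<open>J\<close> is a nonnegative combination of simple roots of \<open>J\<close>, all of which
  become negative.
\<close>

lemma longest_element_flips:
  assumes w: "w \<in> carrier W" "\<forall>s\<in>J. \<forall>t. act w (simple_root s) t \<le> 0"
    and \<beta>: "\<beta> \<in> roots" "\<forall>t. t \<notin> J \<longrightarrow> \<beta> t = 0"
  shows "act w \<beta> \<in> pos_roots \<longleftrightarrow> \<beta> \<notin> pos_roots"
proof -
  have nonpos: "act w \<gamma> \<notin> pos_roots" if \<gamma>: "\<gamma> \<in> pos_roots" "\<forall>t. t \<notin> J \<longrightarrow> \<gamma> t = 0" for \<gamma>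
  proof -
    have r: "\<gamma> \<in> roots" using \<gamma> by (simp add: pos_roots_def)
    have "act w \<gamma> t = (\<Sum>s | \<gamma> s \<noteq> 0. \<gamma> s * act w (simple_root s) t)" for t
      using roots_V[OF r] by (intro act_expand w) (auto simp: V_def)
    also have "\<dots> t \<le> 0" for t
      using \<gamma> r w(2) by (intro sum_nonpos mult_nonneg_nonpos) (auto simp: pos_root_iff)
    finally have "act w \<gamma> t \<le> 0" for t .
    moreover obtain t where "act w \<gamma> t \<noteq> 0" using root_nonzero act_roots w(1) r by blast
    ultimately show ?thesis using pos_root_coord[OF act_roots[OF w(1) r]] by (metis not_less)
  qed
  show ?thesis
  proof (cases "\<beta> \<in> pos_roots")
    case True
    then show ?thesis using nonpos \<beta> by blast
  next
    case False
    then have "(\<lambda>t. - \<beta> t) \<in> pos_roots"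
      using \<beta>(1) neg_root_iff neg_roots_iff_uminus by blast
    then have "act w (\<lambda>t. - \<beta> t) \<notin> pos_roots" using \<beta>(2) by (intro nonpos) auto
    then have "(\<lambda>t. - act w \<beta> t) \<notin> pos_roots" using w(1) \<beta>(1) by (simp add: act_neg roots_V)
    moreover have "act w \<beta> \<in> neg_roots \<Longrightarrow> (\<lambda>t. - act w \<beta> t) \<in> pos_roots"
      by (simp add: neg_roots_iff_uminus)
    ultimately show ?thesis using False neg_root_iff[OF act_roots[OF w(1) \<beta>(1)]] by blast
  qed
qed

definition flip_support :: "'a \<Rightarrow> 'a set \<Rightarrow> ('a \<Rightarrow> real) \<Rightarrow> bool" where
  "flip_support s J \<beta> \<longleftrightarrow> \<beta> s \<noteq> 0 \<and> (\<forall>t. t \<notin> insert s J \<longrightarrow> \<beta> t = 0)"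

text \<open>
  For \<open>s \<notin> J\<close> this describes \<open>w_K w_J\<close> with \<open>K = J \<union> {s}\<close>, the longest among the minimal representatives of
  the cosets \<open>w W_J\<close> in \<open>W_K\<close>, by its effect on the signs of roots. This effect is what
  the square conditions below are read off from.
\<close>

definition relative_longest :: "'a \<Rightarrow> 'a set \<Rightarrow> 'a \<Rightarrow> bool" where
  "relative_longest s J d \<longleftrightarrow> d \<in> generate W (insert s J) \<and>
     (\<forall>\<beta>\<in>roots. act d \<beta> \<in> pos_roots \<longleftrightarrow> (\<beta> \<in> pos_roots) \<noteq> flip_support s J \<beta>)"

text \<open>
  The first factor to act, \<open>w_J\<close>, reverses the signs of the roots supported in \<open>J\<close>, and \<open>w_K\<close>
  reverses all those supported in \<open>K\<close>. So on the roots supported in \<open>J\<close> the two changes cancel. On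
  the other roots supported in \<open>K\<close> only the second takes place, because \<open>w_J\<close> leaves their nonzero
  coordinate at \<open>s\<close> unchanged, and roots not supported in \<open>K\<close> keep their sign for the same reason.
\<close>

lemma relative_longest_exists:
  assumes "finite (carrier W)" "insert s J \<subseteq> S" "s \<notin> J"
  shows "\<exists>d. relative_longest s J d"
proof -
  let ?K = "insert s J"
  obtain x where x: "x \<in> generate W ?K" "\<forall>s\<in>?K. \<forall>t. act x (simple_root s) t \<le> 0"
    using longest_element_exists assms by blast
  obtain y where y: "y \<in> generate W J" "\<forall>s\<in>J. \<forall>t. act y (simple_root s) t \<le> 0"
    using longest_element_exists[of J] assms by blast
  have yK: "y \<in> generate W ?K" using y mono_generate[of J ?K] by blast
  have C: "x \<in> carrier W" "y \<in> carrier W" using x yK assms parabolic_carrier by blast+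
  have dK: "x \<otimes> y \<in> generate W ?K" using x yK by (intro generate.eng)
  have "act (x \<otimes> y) \<beta> \<in> pos_roots \<longleftrightarrow> (\<beta> \<in> pos_roots) \<noteq> flip_support s J \<beta>" if \<beta>: "\<beta> \<in> roots" for \<beta>
  proof -
    have \<beta>V: "\<beta> \<in> V" using \<beta> roots_V by blast
    have fixK: "act z \<beta> t = \<beta> t" if "z \<in> generate W ?K" "t \<notin> ?K" for z t
      using parabolic_coord that assms \<beta>V by blast
    have yr: "act y \<beta> \<in> roots" using \<beta> C act_roots by blast
    have d: "act (x \<otimes> y) \<beta> = act x (act y \<beta>)" using C \<beta>V by (simp add: act_mult)
    consider t where "t \<notin> ?K" "\<beta> t \<noteq> 0"
      | "\<forall>t. t \<notin> ?K \<longrightarrow> \<beta> t = 0" "\<beta> s \<noteq> 0" | "\<forall>t. t \<notin> J \<longrightarrow> \<beta> t = 0" "\<beta> s = 0"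
      by (metis insertE)
    then show ?thesis
    proof cases
      case (1 t)
      then have "act (x \<otimes> y) \<beta> t = \<beta> t" using fixK dK by blast
      then show ?thesis
        using pos_root_coord[OF \<beta>, of t] pos_root_coord[OF act_roots[OF _ \<beta>], of "x \<otimes> y" t] C 1
        by (auto simp: flip_support_def)
    next
      case 2
      have "act y \<beta> s = \<beta> s" using parabolic_coord[OF y(1)] assms \<beta>V 2 by blast
      then have "act y \<beta> \<in> pos_roots \<longleftrightarrow> \<beta> \<in> pos_roots"
        using pos_root_coord[OF \<beta>, of s] pos_root_coord[OF yr, of s] 2 by simp
      moreover have "act x (act y \<beta>) \<in> pos_roots \<longleftrightarrow> act y \<beta> \<notin> pos_roots"
        using fixK[OF yK] 2 by (intro longest_element_flips[OF C(1) x(2) yr]) auto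
      ultimately show ?thesis using 2 d by (auto simp: flip_support_def)
    next
      case 3
      have "act y \<beta> \<in> pos_roots \<longleftrightarrow> \<beta> \<notin> pos_roots"
        using 3 by (intro longest_element_flips[OF C(2) y(2) \<beta>]) auto
      moreover have "act x (act y \<beta>) \<in> pos_roots \<longleftrightarrow> act y \<beta> \<notin> pos_roots"
        using fixK[OF yK] 3 by (intro longest_element_flips[OF C(1) x(2) yr]) auto
      ultimately show ?thesis using 3 d by (auto simp: flip_support_def)
    qed
  qed
  then show ?thesis using dK unfolding relative_longest_def by blast
qed

section \<open>Squares and cubes from relative longest elements\<close>

lemma conj_nontrivial:
  assumes "d \<in> carrier W" "x \<in> carrier W" "x \<noteq> \<one>"
  shows "d \<otimes> x \<otimes> inv d \<in> carrier W - {\<one>}"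
proof -
  have "x = \<one>" if "d \<otimes> x \<otimes> inv d = \<one>"
  proof -
    have "d \<otimes> x = d" using that assms by (metis inv_closed inv_equality inv_inv m_closed)
    then show ?thesis using assms by (metis l_cancel_one)
  qed
  then show ?thesis using assms by auto
qed

lemma flip_support_act:
  assumes "x \<in> generate W J" "J \<subseteq> S" "s \<notin> J" "\<beta> \<in> V"
  shows "flip_support s J (act x \<beta>) \<longleftrightarrow> flip_support s J \<beta>"
  using parabolic_coord[OF assms(1,2,4)] assms(3) by (auto simp: flip_support_def)

lemma relative_longest_carrier: "relative_longest s J d \<Longrightarrow> insert s J \<subseteq> S \<Longrightarrow> d \<in> carrier W"
  unfolding relative_longest_def using parabolic_carrier by blast

text \<open>
  These are the root conditions of a side square, read in both orders of its two directions. For the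
  first, compare \<open>\<beta>\<close> with \<open>\<gamma> = x\<^sup>-\<^sup>1 \<beta>\<close>: if they have opposite signs, they are supported in \<open>J\<close>, where
  \<open>d\<close> keeps signs; conversely, \<open>d\<close> either reverses the signs of both or of neither. For the second,
  \<open>\<Phi>_d\<close> is the image under \<open>d\<close> of the negative roots whose sign \<open>d\<close> reverses, and this set
  of roots is stable under \<open>x\<close>.
\<close>

lemma relative_longest_square:
  assumes d: "relative_longest s J d" and S: "insert s J \<subseteq> S" "s \<notin> J" and x: "x \<in> generate W J"
  shows "act d ` inversions x = inversions (d \<otimes> x \<otimes> inv d)"
    and "act (d \<otimes> x \<otimes> inv d) ` inversions d = inversions d"
proof -
  have dC: "d \<in> carrier W" using relative_longest_carrier[OF d S(1)] .
  have J: "J \<subseteq> S" using S by blast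
  have xC: "x \<in> carrier W" using x J parabolic_carrier by blast
  have cC: "d \<otimes> x \<otimes> inv d \<in> carrier W" using dC xC by simp
  have x': "inv x \<in> generate W J" using x J parabolic_inv by blast
  have inv_c: "inv (d \<otimes> x \<otimes> inv d) = d \<otimes> inv x \<otimes> inv d"
    using dC xC by (simp add: inv_mult_group m_assoc)
  have sign: "act d \<beta> \<in> pos_roots \<longleftrightarrow> (\<beta> \<in> pos_roots) \<noteq> flip_support s J \<beta>" if "\<beta> \<in> roots" for \<beta>
    using d that by (auto simp: relative_longest_def)
  have keep: "act y \<beta> \<in> pos_roots \<longleftrightarrow> \<beta> \<in> pos_roots"
    if "\<beta> \<in> roots" "y \<in> generate W J" "t \<notin> J" "\<beta> t \<noteq> 0" for y \<beta> t
  proof -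
    have "act y \<beta> t = \<beta> t" using parabolic_coord that J roots_V by blast
    moreover have "act y \<beta> \<in> roots" using that J parabolic_carrier act_roots by blast
    ultimately show ?thesis
      using pos_root_coord[of "act y \<beta>" t] pos_root_coord[of \<beta> t] that by simp
  qed
  have inv_sub: "inversions w \<subseteq> roots" for w by (auto simp: inversions_def pos_roots_def)
  show "act d ` inversions x = inversions (d \<otimes> x \<otimes> inv d)"
  proof (rule act_image_eq[OF dC inv_sub inv_sub])
    fix \<beta> assume \<beta>: "\<beta> \<in> roots"
    define \<gamma> where "\<gamma> = act (inv x) \<beta>"
    have \<gamma>: "\<gamma> \<in> roots" unfolding \<gamma>_def using \<beta> xC by (simp add: act_roots)
    have e: "act (inv (d \<otimes> x \<otimes> inv d)) (act d \<beta>) = act d \<gamma>"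
      unfolding inv_c \<gamma>_def using dC xC \<beta> by (simp add: act_mult act_V roots_V act_inv)
    have f: "flip_support s J \<gamma> \<longleftrightarrow> flip_support s J \<beta>"
      unfolding \<gamma>_def by (rule flip_support_act[OF x' J S(2) roots_V[OF \<beta>]])
    have "\<beta> \<in> inversions x \<longleftrightarrow> \<beta> \<in> pos_roots \<and> \<gamma> \<notin> pos_roots"
      using \<beta> by (simp add: inversions_iff[OF xC] \<gamma>_def)
    also have "\<dots> \<longleftrightarrow> act d \<beta> \<in> pos_roots \<and> act d \<gamma> \<notin> pos_roots"
    proof (cases "\<exists>t. t \<notin> J \<and> \<beta> t \<noteq> 0")
      case True
      then have "\<gamma> \<in> pos_roots \<longleftrightarrow> \<beta> \<in> pos_roots" unfolding \<gamma>_def using keep[OF \<beta> x'] by blast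
      then show ?thesis unfolding sign[OF \<beta>] sign[OF \<gamma>] f by blast
    next
      case False
      then have "\<not> flip_support s J \<beta>" using S(2) by (auto simp: flip_support_def)
      then show ?thesis unfolding sign[OF \<beta>] sign[OF \<gamma>] f by blast
    qed
    also have "\<dots> \<longleftrightarrow> act d \<beta> \<in> inversions (d \<otimes> x \<otimes> inv d)"
      unfolding inversions_iff[OF cC] e using \<beta> dC act_roots by blast
    finally show "\<beta> \<in> inversions x \<longleftrightarrow> act d \<beta> \<in> inversions (d \<otimes> x \<otimes> inv d)" .
  qed
  show "act (d \<otimes> x \<otimes> inv d) ` inversions d = inversions d"
  proof (rule act_image_eq[OF cC inv_sub inv_sub])
    fix \<beta> assume \<beta>: "\<beta> \<in> roots"
    define \<gamma> where "\<gamma> = act (inv d) \<beta>"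
    have \<gamma>: "\<gamma> \<in> roots" unfolding \<gamma>_def using \<beta> dC by (simp add: act_roots)
    have x\<gamma>: "act x \<gamma> \<in> roots" using \<gamma> xC act_roots by blast
    have mem: "act d \<delta> \<in> inversions d \<longleftrightarrow> flip_support s J \<delta> \<and> \<delta> \<notin> pos_roots" if "\<delta> \<in> roots" for \<delta>
      using that dC sign[OF that] by (auto simp: inversions_iff act_inv roots_V act_roots)
    have "flip_support s J \<gamma> \<Longrightarrow> act x \<gamma> \<in> pos_roots \<longleftrightarrow> \<gamma> \<in> pos_roots"
      using keep[OF \<gamma> x S(2)] by (simp add: flip_support_def)
    then have "act d \<gamma> \<in> inversions d \<longleftrightarrow> act d (act x \<gamma>) \<in> inversions d"
      unfolding mem[OF \<gamma>] mem[OF x\<gamma>] flip_support_act[OF x J S(2) roots_V[OF \<gamma>]] by blast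
    then show "\<beta> \<in> inversions d \<longleftrightarrow> act (d \<otimes> x \<otimes> inv d) \<beta> \<in> inversions d"
      unfolding \<gamma>_def using dC xC \<beta> by (simp add: act_mult act_inv' act_V roots_V)
  qed
qed

text \<open>
  The simple root of \<open>s\<close> becomes negative under \<open>d\<close>.
\<close>

lemma relative_longest_nontrivial:
  assumes "relative_longest s J d" "insert s J \<subseteq> S"
  shows "d \<noteq> \<one>"
proof
  assume "d = \<one>"
  moreover have "simple_root s \<in> roots" "flip_support s J (simple_root s)"
    using assms(2) by (auto simp: simple_root_roots flip_support_def) (auto simp: simple_root_def)
  ultimately show False
    using assms by (auto simp: relative_longest_def act_one simple_root_V)
qed

text \<open>
  Conjugation by \<open>d\<close> is compatible with \<open>x \<mapsto> \<Phi>_x\<close> on \<open>W_J\<close>: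
  \<open>d w d\<^sup>-\<^sup>1 (\<Phi>_(d x d\<^sup>-\<^sup>1)) = d w (\<Phi>_x) = d (\<Phi>_y) = \<Phi>_(d y d\<^sup>-\<^sup>1)\<close>.
\<close>

lemma conj_square:
  assumes d: "relative_longest s J d" and S: "insert s J \<subseteq> S" "s \<notin> J"
    and sq: "coxeter_square w x y z" and J: "{w, x, y, z} \<subseteq> generate W J"
  shows "coxeter_square (d \<otimes> w \<otimes> inv d) (d \<otimes> x \<otimes> inv d) (d \<otimes> y \<otimes> inv d) (d \<otimes> z \<otimes> inv d)"
proof -
  have dC: "d \<in> carrier W" using relative_longest_carrier[OF d S(1)] .
  have C: "w \<in> carrier W" "x \<in> carrier W" "y \<in> carrier W" "z \<in> carrier W"
    and ne: "w \<noteq> \<one>" "x \<noteq> \<one>" "y \<noteq> \<one>" "z \<noteq> \<one>"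
    and eq: "w \<otimes> x = y \<otimes> z" and im: "act w ` inversions x = inversions y"
    using sq by (auto simp: coxeter_square_def)
  have conj: "d \<otimes> a \<otimes> inv d \<in> carrier W - {\<one>}" if "a \<in> carrier W" "a \<noteq> \<one>" for a
    using conj_nontrivial dC that by blast
  have mult: "(d \<otimes> a \<otimes> inv d) \<otimes> (d \<otimes> b \<otimes> inv d) = d \<otimes> (a \<otimes> b) \<otimes> inv d"
    if "a \<in> carrier W" "b \<in> carrier W" for a b
  proof -
    have "inv d \<otimes> (d \<otimes> (b \<otimes> inv d)) = b \<otimes> inv d"
      using dC that by (simp add: m_assoc[symmetric])
    then show ?thesis using dC that by (simp add: m_assoc)
  qed
  have V: "\<beta> \<in> V" if "\<beta> \<in> inversions x" for \<beta>
    using that by (auto simp: inversions_def pos_roots_def roots_V)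
  have "act (d \<otimes> w \<otimes> inv d) ` inversions (d \<otimes> x \<otimes> inv d)
      = act (d \<otimes> w \<otimes> inv d) ` act d ` inversions x"
    using relative_longest_square(1)[OF d S] J by simp
  also have "\<dots> = act d ` act w ` inversions x"
    unfolding image_image using dC C V by (intro image_cong) (auto simp: act_mult act_V act_inv)
  also have "\<dots> = inversions (d \<otimes> y \<otimes> inv d)"
    unfolding im using relative_longest_square(1)[OF d S] J by simp
  finally show ?thesis
    using conj C ne eq mult by (simp add: coxeter_square_def)
qed

lemma side_squares:
  assumes d: "relative_longest s J d" and S: "insert s J \<subseteq> S" "s \<notin> J"
    and x: "x \<in> generate W J" "x \<noteq> \<one>"
  shows "coxeter_square d x (d \<otimes> x \<otimes> inv d) d" "coxeter_square (d \<otimes> x \<otimes> inv d) d d x"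
proof -
  have dC: "d \<in> carrier W" using relative_longest_carrier[OF d S(1)] .
  have xC: "x \<in> carrier W" using x(1) S parabolic_carrier by blast
  have "d \<otimes> x \<otimes> inv d \<otimes> d = d \<otimes> x" using dC xC by (simp add: m_assoc)
  then show "coxeter_square d x (d \<otimes> x \<otimes> inv d) d" "coxeter_square (d \<otimes> x \<otimes> inv d) d d x"
    using relative_longest_square[OF d S x(1)] conj_nontrivial[OF dC xC x(2)] dC xC x(2)
      relative_longest_nontrivial[OF d S(1)]
    by (auto simp: coxeter_square_def)
qed

text \<open>
  Coordinates count from 0, so \<open>k\<close> is the new direction of a cube that had dimension \<open>k\<close>. The
  vertices with \<open>v k = 0\<close> span the old cube, and the other ones span the conjugated copy.
  Restricting \<open>v\<close> to the old coordinates makes it an extensional vertex of the old cube.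
\<close>

definition extend_cube :: "nat \<Rightarrow> 'a \<Rightarrow> ((nat \<Rightarrow> nat) \<times> nat \<Rightarrow> 'a) \<Rightarrow> (nat \<Rightarrow> nat) \<times> nat \<Rightarrow> 'a" where
  "extend_cube k d l = (\<lambda>(v, i)\<in>cube_edges (Suc k).
     if i = k then d
     else if v k = 0 then l (restrict v {..<k}, i)
     else d \<otimes> l (restrict v {..<k}, i) \<otimes> inv d)"

lemma extend_cube_in_cubes:
  assumes d: "relative_longest s J d" and S: "insert s J \<subseteq> S" "s \<notin> J"
    and l: "l \<in> coxeter_cubes k" and lJ: "\<forall>e\<in>cube_edges k. l e \<in> generate W J"
  shows "extend_cube k d l \<in> coxeter_cubes (Suc k)"
    and "\<forall>e\<in>cube_edges (Suc k). extend_cube k d l e \<in> generate W (insert s J)"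
proof -
  let ?l = "extend_cube k d l" and ?r = "\<lambda>v :: nat \<Rightarrow> nat. restrict v {..<k}"
  have dK: "d \<in> generate W (insert s J)" using d by (simp add: relative_longest_def)
  have dC: "d \<in> carrier W" using relative_longest_carrier[OF d S(1)] .
  have d1: "d \<noteq> \<one>" using relative_longest_nontrivial[OF d S(1)] .
  have rv: "?r v \<in> cube_vertices k" if "v \<in> cube_vertices (Suc k)" for v
    using that by (auto simp: cube_vertices_def PiE_iff)
  have up: "v(i := 1) \<in> cube_vertices n" if "v \<in> cube_vertices n" "i < n" for v i n
    using that by (auto simp: cube_vertices_def PiE_iff extensional_def)
  have lower: "(?r v, i) \<in> cube_edges k" if "(v, i) \<in> cube_edges (Suc k)" "i \<noteq> k" for v i
    using that rv by (auto simp: cube_edges_def)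
  have JK: "x \<in> generate W (insert s J)" if "x \<in> generate W J" for x
    using that mono_generate[of J "insert s J"] by blast
  have lab: "l e \<in> generate W J" "l e \<in> carrier W" "l e \<noteq> \<one>" if "e \<in> cube_edges k" for e
    using that l lJ by (auto simp: coxeter_cubes_def)
  have val: "?l (v, i) = (if i = k then d else if v k = 0 then l (?r v, i) else d \<otimes> l (?r v, i) \<otimes> inv d)"
    if "(v, i) \<in> cube_edges (Suc k)" for v i
    using that by (simp add: extend_cube_def)
  show "\<forall>e\<in>cube_edges (Suc k). ?l e \<in> generate W (insert s J)"
  proof
    fix e assume e: "e \<in> cube_edges (Suc k)"
    obtain v i where vi: "e = (v, i)" by (cases e)
    have "inv d \<in> generate W (insert s J)" using dK S parabolic_inv by blast
    then show "?l e \<in> generate W (insert s J)"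
      using e dK JK lab lower unfolding vi val[OF e[unfolded vi]] by (auto intro!: generate.eng)
  qed
  have labels: "?l \<in> cube_edges (Suc k) \<rightarrow>\<^sub>E (carrier W - {\<one>})"
  proof (rule PiE_I)
    fix e assume e: "e \<in> cube_edges (Suc k)"
    obtain v i where vi: "e = (v, i)" by (cases e)
    show "?l e \<in> carrier W - {\<one>}"
      using e d1 dC lab lower conj_nontrivial[OF dC] unfolding vi val[OF e[unfolded vi]] by auto
  qed (simp add: extend_cube_def)
  have square: "coxeter_square (?l (v(i := 1), j)) (?l (v, i)) (?l (v(j := 1), i)) (?l (v, j))"
    if v: "v \<in> cube_vertices (Suc k)" and ij: "i < Suc k" "j < Suc k" "i \<noteq> j" "v i = 0" "v j = 0"
    for v i j
  proof -
    have e: "(v(i := 1), j) \<in> cube_edges (Suc k)" "(v, i) \<in> cube_edges (Suc k)"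
      "(v(j := 1), i) \<in> cube_edges (Suc k)" "(v, j) \<in> cube_edges (Suc k)"
      using v ij up[OF v] by (auto simp: cube_edges_def)
    have r: "?r (v(h := 1)) = (if h < k then (?r v)(h := 1) else ?r v)" for h
      by (auto simp: restrict_def)
    have sq: "coxeter_square (l ((?r v)(i := 1), j)) (l (?r v, i)) (l ((?r v)(j := 1), i)) (l (?r v, j))"
      if "i < k" "j < k"
      using l rv[OF v] that ij by (auto simp: coxeter_cubes_def)
    have edges: "((?r v)(i := 1), j) \<in> cube_edges k" "((?r v)(j := 1), i) \<in> cube_edges k"
        "(?r v, i) \<in> cube_edges k" "(?r v, j) \<in> cube_edges k"
      if "i < k" "j < k"
      using that ij rv[OF v] up[OF rv[OF v]] by (auto simp: cube_edges_def)
    consider "i < k" "j < k" "v k = 0" | "i < k" "j < k" "v k \<noteq> 0" | "i < k" "j = k" | "i = k" "j < k"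
      using ij by linarith
    then show ?thesis
    proof cases
      case 1
      then show ?thesis using sq by (simp add: val[OF e(1)] val[OF e(2)] val[OF e(3)] val[OF e(4)] r del: One_nat_def)
    next
      case 2
      have "coxeter_square (d \<otimes> l ((?r v)(i := 1), j) \<otimes> inv d) (d \<otimes> l (?r v, i) \<otimes> inv d)
          (d \<otimes> l ((?r v)(j := 1), i) \<otimes> inv d) (d \<otimes> l (?r v, j) \<otimes> inv d)"
        using 2 edges lab by (intro conj_square[OF d S sq]) auto
      then show ?thesis
        using 2 by (simp add: val[OF e(1)] val[OF e(2)] val[OF e(3)] val[OF e(4)] r del: One_nat_def)
    next
      case 3
      then show ?thesis
        using ij lab[OF lower[OF e(2)]] side_squares(1)[OF d S]
        unfolding val[OF e(1)] val[OF e(2)] val[OF e(3)] val[OF e(4)] r by simp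
    next
      case 4
      then show ?thesis
        using ij lab[OF lower[OF e(4)]] side_squares(2)[OF d S]
        unfolding val[OF e(1)] val[OF e(2)] val[OF e(3)] val[OF e(4)] r by simp
    qed
  qed
  show "?l \<in> coxeter_cubes (Suc k)"
    unfolding coxeter_cubes_def using labels square by blast
qed

text \<open>
  The labels are confined to the parabolic subgroup of \<open>J\<close> so that the induction goes through: the
  next relative longest element is only controlled against elements of that subgroup.
\<close>

lemma parabolic_cube_exists:
  assumes "finite (carrier W)" "finite J" "J \<subseteq> S"
  shows "\<exists>l \<in> coxeter_cubes (card J). \<forall>e\<in>cube_edges (card J). l e \<in> generate W J"
  using assms(2,3)
proof (induction J rule: finite_induct)
  case empty
  have "cube_edges 0 = {}" by (auto simp: cube_edges_def)
  then show ?case by (auto simp: coxeter_cubes_def)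
next
  case (insert s J)
  then obtain l where l: "l \<in> coxeter_cubes (card J)" "\<forall>e\<in>cube_edges (card J). l e \<in> generate W J"
    by auto
  obtain d where "relative_longest s J d"
    using relative_longest_exists[OF assms(1) insert.prems insert.hyps(2)] by blast
  note ext = extend_cube_in_cubes[OF this insert.prems insert.hyps(2) l]
  show ?case unfolding card_insert_disjoint[OF insert.hyps] using ext by blast
qed

lemma Cubes_ge_1:
  assumes "l \<in> coxeter_cubes n"
  shows "Cubes n \<ge> 1"
proof -
  let ?Q = "coxeter_cubes n // reorientation n"
  have "?Q \<noteq> {}" using assms by (auto simp: quotient_def)
  then have "finite ?Q \<Longrightarrow> card ?Q \<ge> 1" by (simp add: Suc_le_eq card_gt_0_iff)
  then show ?thesis by (simp add: Cubes_def Let_def one_enat_def)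
qed

end

theorem proposition5p2:
  fixes W :: "('w, 'b) monoid_scheme" and S :: "'w set" and m :: "'w \<Rightarrow> 'w \<Rightarrow> nat" and n :: nat
  assumes "n \<ge> 1"
    and "coxeter_system W S m"
    and "finite (carrier W)"
    and "card S = n"
  shows "coxeter_system.Cubes W S m n \<ge> 1 \<and> (\<exists>l. l \<in> coxeter_system.coxeter_cubes W S m n)"
proof -
  interpret coxeter_system W S m by fact
  have "finite S" using assms(3) S_subset finite_subset by blast
  then obtain l where "l \<in> coxeter_cubes n"
    using parabolic_cube_exists[OF assms(3)] assms(4) by blast
  then show ?thesis using Cubes_ge_1 by blast
qed

end
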